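(* Let $G$ be a countably infinite discrete group, let $(X,G,\alpha)$ be a topological dynamical system, and let $H\leq G$ be a subgroup with $[G:H]<+\infty$. Then for every $k\in\mathbb{N}$, $$IN_k(X,G)=IN_k(X,H),$$ where $H$ acts on $X$ by the restriction $\alpha|_H$.
   Context: A topological dynamical system (t.d.s.) $(X,G,\alpha)$ consists of a compact metric space $X$, a group $G$, and an action $(g,x)\mapsto\alpha_g(x)$ of $G$ on $X$ by homeomorphisms. $\mathbb{N}=\{1,2,\dots\}$ and $[k]=\{1,\dots,k\}$. A set $I\subseteq G$ is an independence set for a tuple $(A_1,\dots,A_k)$ of subsets of $X$ if $\bigcap_{g\in F}\alpha_{g^{-1}}(A_{\omega(g)})\neq\emptyset$ for every non-empty finite $F\subseteq I$ and every function $\omega:F\to[k]$. A tuple $(x_1,\dots,x_k)\in X^k$ is an $IN$-tuple if for every product neighborhood $U_1\times\dots\times U_k$ of $(x_1,\dots,x_k)$ the tuple $(U_1,\dots,U_k)$ has arbitrarily large finite independence sets. $IN_k(X,G)$ denotes the set of $IN$-tuples of length $k$; $IN_k(X,H)$ is the same notion with independence sets required to be subsets of the acting group $H$. *)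

theory Defs
  imports "HOL-Analysis.Analysis" "HOL-Algebra.Group_Action"
begin

text \<open>
  A group \<open>G\<close> acting by homeomorphisms on the compact metric space \<open>(X, d)\<close>. As in
  \<^locale>\<open>group_action\<close>, the maps \<open>\<alpha> g\<close> are extensional on \<open>X\<close>, which only fixes their
  irrelevant values outside \<open>X\<close>. The group carries no topology, i.e. it is discrete.
\<close>

locale topological_dynamical_system =
  group_action G X \<alpha> + Metric_space X d
  for G :: "('g, 'm) monoid_scheme" (structure)
    and X :: "'x set" and d :: "'x \<Rightarrow> 'x \<Rightarrow> real" and \<alpha> :: "'g \<Rightarrow> 'x \<Rightarrow> 'x" +
  assumes compact_space_X: "compact_space mtopology"
    and homeomorphic_action: "g \<in> carrier G \<Longrightarrow> homeomorphic_map mtopology mtopology (\<alpha> g)"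

text \<open>
  A \<open>k\<close>-tuple is a function on \<open>nat\<close> of which only the values on \<open>{1..k}\<close> matter; tuples of
  points are made extensional, so that \<open>X\<^sup>k\<close> is \<open>{1..k} \<rightarrow>\<^sub>E X\<close>.
\<close>

definition independence_set ::
  "('g, 'm) monoid_scheme \<Rightarrow> ('g \<Rightarrow> 'x \<Rightarrow> 'x) \<Rightarrow> nat \<Rightarrow> (nat \<Rightarrow> 'x set) \<Rightarrow> 'g set \<Rightarrow> bool"
  where "independence_set G \<alpha> k A I \<longleftrightarrow>
    I \<subseteq> carrier G \<and>
    (\<forall>F \<omega>. F \<subseteq> I \<and> finite F \<and> F \<noteq> {} \<and> \<omega> \<in> F \<rightarrow> {1..k} \<longrightarrow>
      (\<Inter>g\<in>F. \<alpha> (inv\<^bsub>G\<^esub> g) ` A (\<omega> g)) \<noteq> {})"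

text \<open>Neighbourhoods are not required to be open.\<close>

definition IN_tuples ::
  "('g, 'm) monoid_scheme \<Rightarrow> 'x topology \<Rightarrow> ('g \<Rightarrow> 'x \<Rightarrow> 'x) \<Rightarrow> nat \<Rightarrow> (nat \<Rightarrow> 'x) set"
  where "IN_tuples G T \<alpha> k =
    {x \<in> {1..k} \<rightarrow>\<^sub>E topspace T.
      \<forall>U. (\<forall>i\<in>{1..k}. U i \<subseteq> topspace T \<and> x i \<in> T interior_of U i) \<longrightarrow>
        (\<forall>n. \<exists>I. finite I \<and> n \<le> card I \<and> independence_set G \<alpha> k U I)}"

lemma (in topological_dynamical_system) restrict_subgroup:
  assumes "subgroup H G"
  shows "topological_dynamical_system (G\<lparr>carrier := H\<rparr>) X d (restrict \<alpha> H)"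
proof -
  have hom: "group_hom G (BijGroup X) \<alpha>"
    by (rule group_hom)
  then interpret G: group G
    by (simp add: group_hom_def)
  have sub: "g \<in> carrier G" if "g \<in> H" for g
    using assms that by (rule subgroup.mem_carrier)
  have "restrict \<alpha> H \<in> hom (G\<lparr>carrier := H\<rparr>) (BijGroup X)"
    using hom assms sub
    by (auto simp: group_hom_def group_hom_axioms_def hom_def subgroup.m_closed)
  then have "group_action (G\<lparr>carrier := H\<rparr>) X (restrict \<alpha> H)"
    using G.subgroup_imp_group[OF assms] group_BijGroup
    by (simp add: group_action_def group_hom_def group_hom_axioms_def)
  then show ?thesis
    using Metric_space_axioms compact_space_X homeomorphic_action sub
    by (simp add: topological_dynamical_system_def topological_dynamical_system_axioms_def)
qed

end

theory Submission
  imports Defs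
begin

text \<open>
  A right translate \<open>I c\<close> of an independence set \<open>I\<close> is again an independence set for the same
  tuple, since \<open>\<alpha>\<close> at \<open>(g c)\<inverse>\<close> is \<open>\<alpha>\<close> at \<open>c\<inverse>\<close> composed with \<open>\<alpha>\<close> at \<open>g\<inverse>\<close>.
  A large finite independence set in \<open>G\<close> meets one of the finitely many cosets \<open>H c\<close> in a large
  set, and translating this part by \<open>c\<inverse>\<close> moves it into \<open>H\<close>.
\<close>

lemma independence_set_subset:
  assumes "independence_set G \<alpha> k A I" "J \<subseteq> I"
  shows "independence_set G \<alpha> k A J"
  using assms unfolding independence_set_def by (meson subset_trans)

text \<open>Inverses of elements of \<open>H\<close> agree in \<open>H\<close> and in
  \<open>G\<close>, so for index sets inside \<open>H\<close> both sides involve the same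
  intersections. Passing to \<open>H\<close> thus only adds the constraint
  \<open>I \<subseteq> H\<close>.\<close>

lemma independence_set_subgroup_iff:
  fixes G (structure)
  assumes "group G" "subgroup H G"
  shows "independence_set (G\<lparr>carrier := H\<rparr>) (restrict \<alpha> H) k A I \<longleftrightarrow>
    I \<subseteq> H \<and> independence_set G \<alpha> k A I"
proof (cases "I \<subseteq> H")
  case True
  have "(\<Inter>g\<in>F. restrict \<alpha> H (inv\<^bsub>G\<lparr>carrier := H\<rparr>\<^esub> g) ` A (\<omega> g)) = (\<Inter>g\<in>F. \<alpha> (inv g) ` A (\<omega> g))"
    if "F \<subseteq> I" for F and \<omega> :: "'a \<Rightarrow> nat"
    using that True assms
    by (intro INF_cong) (auto simp: group.m_inv_consistent subgroup.m_inv_closed subset_iff)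
  moreover have "I \<subseteq> carrier G"
    using True subgroup.subset[OF assms(2)] by (rule subset_trans)
  ultimately show ?thesis
    using True unfolding independence_set_def by (simp cong: conj_cong imp_cong)
next
  case False
  then show ?thesis
    by (simp add: independence_set_def)
qed

lemma (in group_action) independence_set_r_coset:
  assumes I: "independence_set G \<phi> k A I" and c: "c \<in> carrier G"
    and A: "\<And>i. i \<in> {1..k} \<Longrightarrow> A i \<subseteq> E"
  shows "independence_set G \<phi> k A (I #> c)"
proof -
  interpret group G
    using group_hom by (simp add: group_hom_def)
  have IG: "I \<subseteq> carrier G"
    using I by (simp add: independence_set_def)
  have "(\<Inter>g\<in>F. \<phi> (inv g) ` A (\<omega> g)) \<noteq> {}"
    if F: "F \<subseteq> I #> c" "finite F" "F \<noteq> {}" and \<omega>: "\<omega> \<in> F \<rightarrow> {1..k}" for F \<omega>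
  proof -
    \<comment> \<open>This is \<open>F\<close> translated back by \<open>inv c\<close>. Colouring
      \<open>g\<close> in it by the colour of \<open>g \<otimes> c\<close> turns the pattern on
      \<open>F\<close> into one on a subset of \<open>I\<close>.\<close>
    let ?F' = "{g \<in> I. g \<otimes> c \<in> F}"
    have F_eq: "F = (\<lambda>g. g \<otimes> c) ` ?F'"
      using F(1) by (auto simp: r_coset_def)
    have "inj_on (\<lambda>g. g \<otimes> c) ?F'"
      using IG c by (auto simp: inj_on_def subset_iff)
    then have "finite ?F'"
      using F(2) F_eq by (metis finite_image_iff)
    moreover have "?F' \<noteq> {}"
      using F(3) F_eq by blast
    moreover have "(\<lambda>g. \<omega> (g \<otimes> c)) \<in> ?F' \<rightarrow> {1..k}"
      using \<omega> by auto
    ultimately have "(\<Inter>g\<in>?F'. \<phi> (inv g) ` A (\<omega> (g \<otimes> c))) \<noteq> {}"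
      using I unfolding independence_set_def
      by (elim conjE allE[of _ ?F'] allE[of _ "\<lambda>g. \<omega> (g \<otimes> c)"]) auto
    then obtain p where p: "\<And>g. g \<in> ?F' \<Longrightarrow> p \<in> \<phi> (inv g) ` A (\<omega> (g \<otimes> c))"
      by blast
    \<comment> \<open>If \<open>p\<close> realizes the pulled-back pattern, its image under
      \<open>\<phi> (inv c)\<close> realizes the original one.\<close>
    have "\<phi> (inv c) p \<in> \<phi> (inv (g \<otimes> c)) ` A (\<omega> (g \<otimes> c))" if g: "g \<in> ?F'" for g
    proof -
      obtain a where a: "a \<in> A (\<omega> (g \<otimes> c))" "p = \<phi> (inv g) a"
        using p[OF g] by blast
      have gG: "g \<in> carrier G"
        using g IG by blast
      have "\<omega> (g \<otimes> c) \<in> {1..k}"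
        using g \<omega> by auto
      \<comment> \<open>The composition rule for the action is available only at points of
        \<open>E\<close>; this is where \<open>A\<close> enters.\<close>
      then have "a \<in> E"
        using a(1) A by blast
      then have "\<phi> (inv (g \<otimes> c)) a = \<phi> (inv c) p"
        using gG c a(2) by (simp add: inv_mult_group composition_rule)
      then show ?thesis
        using a(1) by (metis imageI)
    qed
    then have "\<phi> (inv c) p \<in> (\<Inter>g\<in>F. \<phi> (inv g) ` A (\<omega> g))"
      by (subst F_eq) (simp only: image_image INT_iff ball_simps, blast)
    then show ?thesis
      by blast
  qed
  moreover have "I #> c \<subseteq> carrier G"
    using IG c by (rule r_coset_subset_G)
  ultimately show ?thesis
    unfolding independence_set_def by blast
qed

text \<open>Pigeonhole by the union bound, so the members of the cover may overlap.\<close>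

lemma large_intersection_in_finite_cover:
  assumes "finite I" "finite \<C>" "I \<subseteq> \<Union>\<C>" "card \<C> * n < card I"
  shows "\<exists>C\<in>\<C>. n \<le> card (I \<inter> C)"
proof (rule ccontr)
  assume "\<not> ?thesis"
  then have small: "card (I \<inter> C) \<le> n" if "C \<in> \<C>" for C
    using that by (simp add: not_le less_imp_le)
  have "card I = card (\<Union>C\<in>\<C>. I \<inter> C)"
    using assms(3) by (intro arg_cong[of _ _ card]) blast
  also have "\<dots> \<le> (\<Sum>C\<in>\<C>. card (I \<inter> C))"
    using assms(2) by (rule card_UN_le)
  also have "\<dots> \<le> card \<C> * n"
    using sum_bounded_above[of \<C> "\<lambda>C. card (I \<inter> C)" n] small by simp
  finally show False
    using assms(4) by simp
qed

lemma (in group_action) large_independence_set_in_subgroup: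
  assumes H: "subgroup H G" and fin: "finite (rcosets H)"
    and U: "\<forall>i\<in>{1..k}. U i \<subseteq> E"
    and large: "\<forall>n. \<exists>I. finite I \<and> n \<le> card I \<and> independence_set G \<phi> k U I"
  shows "\<exists>J. finite J \<and> n \<le> card J \<and> J \<subseteq> H \<and> independence_set G \<phi> k U J"
proof -
  interpret group G
    using group_hom by (simp add: group_hom_def)
  \<comment> \<open>Exceeding \<open>n\<close> times the index forces at least \<open>n\<close>
    elements into one coset.\<close>
  obtain I where I: "finite I" "card (rcosets H) * n < card I" "independence_set G \<phi> k U I"
    using large by (metis Suc_le_eq)
  then have IG: "I \<subseteq> carrier G"
    by (simp add: independence_set_def)
  then have "I \<subseteq> \<Union>(rcosets H)"
    by (simp add: rcosets_part_G[OF H])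
  then obtain C where C: "C \<in> rcosets H" "n \<le> card (I \<inter> C)"
    using large_intersection_in_finite_cover[OF I(1) fin _ I(2)] by blast
  then obtain c where c: "c \<in> carrier G" "C = H #> c"
    by (auto simp: RCOSETS_def)
  interpret H: subgroup H G
    by fact
  \<comment> \<open>Right translation by \<open>inv c\<close> carries \<open>H #> c\<close> to
    \<open>H\<close> and, being injective, keeps the cardinality.\<close>
  let ?J = "(I \<inter> C) #> inv c"
  have J_eq: "?J = (\<lambda>g. g \<otimes> inv c) ` (I \<inter> C)"
    by (auto simp: r_coset_def)
  have "inj_on (\<lambda>g. g \<otimes> inv c) (I \<inter> C)"
    using IG c(1) by (auto simp: inj_on_def subset_iff)
  then have "card ?J = card (I \<inter> C)"
    unfolding J_eq by (rule card_image)
  moreover have "?J \<subseteq> H"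
    using c by (auto simp: r_coset_def m_assoc)
  moreover have "independence_set G \<phi> k U ?J"
    using independence_set_r_coset[OF independence_set_subset[OF I(3)]] c(1) U by simp
  ultimately show ?thesis
    using C(2) I(1) J_eq by (metis finite_Int finite_imageI)
qed

theorem proposition3p1:
  fixes G :: "('g, 'm) monoid_scheme" and H :: "'g set"
    and X :: "'x set" and d :: "'x \<Rightarrow> 'x \<Rightarrow> real" and \<alpha> :: "'g \<Rightarrow> 'x \<Rightarrow> 'x" and k :: nat
  assumes "group G" and "countable (carrier G)" and "infinite (carrier G)"
    and "topological_dynamical_system G X d \<alpha>"
    and "subgroup H G" and "finite (rcosets\<^bsub>G\<^esub> H)"
    and "k \<ge> 1"
  shows "IN_tuples G (Metric_space.mtopology X d) \<alpha> k =
         IN_tuples (G\<lparr>carrier := H\<rparr>) (Metric_space.mtopology X d) (restrict \<alpha> H) k"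
proof -
  interpret topological_dynamical_system G X d \<alpha>
    by fact
  \<comment> \<open>The condition on the neighbourhoods \<open>U\<close> does not involve the group,
    so it suffices to compare the independence sets for each fixed \<open>U\<close>. From right to
    left, the same \<open>I\<close> serves, as independence sets in \<open>H\<close> are
    independence sets in \<open>G\<close>.\<close>
  have eq: "(\<forall>n. \<exists>I. finite I \<and> n \<le> card I \<and> independence_set G \<alpha> k U I) \<longleftrightarrow>
      (\<forall>n. \<exists>I. finite I \<and> n \<le> card I \<and>
        independence_set (G\<lparr>carrier := H\<rparr>) (restrict \<alpha> H) k U I)"
    if "\<forall>i\<in>{1..k}. U i \<subseteq> X" for U
    unfolding independence_set_subgroup_iff[OF assms(1,5)]
    using large_independence_set_in_subgroup[OF assms(5,6) that] by meson
  show ?thesis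
    unfolding IN_tuples_def topspace_mtopology
    by (rule Collect_cong, rule conj_cong[OF refl], rule all_cong1, rule imp_cong[OF refl], rule eq)
      blast
qed

end
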